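(* Let $m,n,M,N$ be positive integers with $m\le M$ and $n\le N$, let $p_{ij}\in\mathbb{R}$ for $i\in\{1,\ldots,M\}$, $j\in\{1,\ldots,N\}$, let $y_1,\ldots,y_M$ be pairwise distinct real numbers and $z_1,\ldots,z_N$ be pairwise distinct real numbers, and let $f:I_1\times J_1\to\mathbb{R}$ be a (discrete) function, where $y_i\in I_1\subset\mathbb{R}$ and $z_j\in J_1\subset\mathbb{R}$ for all $i,j$. Then \begin{align*} &\sum_{i=1}^M\sum_{j=1}^N p_{ij}f(y_i,z_j)\\ &=\sum_{k=0}^{n-1}\sum_{t=0}^{m-1}\sum_{s=1}^{M-t}\sum_{r=1}^{N-k}p_{sr}(z_N-z_r)^{\{k\}}(y_M-y_s)^{\{t\}}\,\nabla_{(t,k)}f(y_{M-t},z_{N-k})\\ &\quad+\sum_{k=0}^{n-1}\sum_{t=1}^{M-m}\sum_{s=1}^{t}\sum_{r=1}^{N-k}p_{sr}(z_N-z_r)^{\{k\}}(y_{t+m-1}-y_s)^{\{m-1\}}\,\nabla_{(m,k)}f(y_t,z_{N-k})\,(y_{t+m}-y_t)\\ &\quad+\sum_{k=1}^{N-n}\sum_{t=0}^{m-1}\sum_{s=1}^{M-t}\sum_{r=1}^{k}p_{sr}(z_{k+n-1}-z_r)^{\{n-1\}}(y_M-y_s)^{\{t\}}\,\nabla_{(t,n)}f(y_{M-t},z_k)\,(z_{k+n}-z_k)\\ &\quad+\sum_{k=1}^{N-n}\sum_{t=1}^{M-m}\sum_{s=1}^{t}\sum_{r=1}^{k}p_{sr}(z_{k+n-1}-z_r)^{\{n-1\}}(y_{t+m-1}-y_s)^{\{m-1\}}\,\nabla_{(m,n)}f(y_t,z_k)\,(y_{t+m}-y_t)(z_{k+n}-z_k).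 \end{align*}
   Context: Notation: $(y_k-y_i)^{\{0\}}=1$ and $(y_k-y_i)^{\{l+1\}}=(y_k-y_i)(y_{k-1}-y_i)\cdots(y_{k-l}-y_i)$ for $l\ge0$; similarly for the $z$'s. For a function $g$ of one variable and distinct points, $[x_j;g]=g(x_j)$ and $[x_i,\ldots,x_{i+l};g]=\dfrac{[x_{i+1},\ldots,x_{i+l};g]-[x_i,\ldots,x_{i+l-1};g]}{x_{i+l}-x_i}$. For a function $f$ of two variables, $\Delta_{(t,k)}f(y_i,z_j)=[y_i,\ldots,y_{i+t};[z_j,\ldots,z_{j+k};f]]$ (divided difference in $z$ with the first variable fixed, then in $y$), and $\nabla_{(t,k)}f(y_i,z_j)=(-1)^{t+k}\Delta_{(t,k)}f(y_i,z_j)$. Empty sums are zero. *)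

theory Defs
  imports Complex_Main
begin

text \<open>
  The points are sequences \<open>x :: nat \<Rightarrow> real\<close>, indexed from 1; \<open>gen_power x k i l\<close> stands for
  \<open>(x\<^sub>k - x\<^sub>i)\<^bsup>{l}\<^esup> = (x\<^sub>k - x\<^sub>i) (x\<^bsub>k-1\<^esub> - x\<^sub>i) \<dots> (x\<^bsub>k-l+1\<^esub> - x\<^sub>i)\<close>.
  It is only meaningful for \<open>l \<le> k\<close>, where \<open>k - j\<close> is never truncated.
\<close>

definition gen_power :: "(nat \<Rightarrow> real) \<Rightarrow> nat \<Rightarrow> nat \<Rightarrow> nat \<Rightarrow> real" where
  "gen_power x k i l = (\<Prod>j<l. (x (k - j) - x i))"

text \<open>
  \<open>divdiff x g i l\<close> is \<open>[x\<^sub>i, \<dots>, x\<^bsub>i+l\<^esub>; g]\<close>: the points are given by their starting index \<open>i\<close>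
  and the order \<open>l\<close> of the divided difference.
\<close>

primrec divdiff :: "(nat \<Rightarrow> real) \<Rightarrow> (real \<Rightarrow> real) \<Rightarrow> nat \<Rightarrow> nat \<Rightarrow> real" where
  "divdiff x g i 0 = g (x i)"
| "divdiff x g i (Suc l) =
     (divdiff x g (Suc i) l - divdiff x g i l) / (x (i + Suc l) - x i)"

text \<open>\<open>\<Delta>\<^bsub>(t,k)\<^esub> f(y\<^sub>i, z\<^sub>j)\<close> and \<open>\<nabla>\<^bsub>(t,k)\<^esub> f(y\<^sub>i, z\<^sub>j)\<close>\<close>

definition Delta ::
  "(nat \<Rightarrow> real) \<Rightarrow> (nat \<Rightarrow> real) \<Rightarrow> nat \<Rightarrow> nat \<Rightarrow> (real \<Rightarrow> real \<Rightarrow> real) \<Rightarrow> nat \<Rightarrow> nat \<Rightarrow> real" where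
  "Delta y z t k f i j = divdiff y (\<lambda>u. divdiff z (\<lambda>v. f u v) j k) i t"

definition Nabla ::
  "(nat \<Rightarrow> real) \<Rightarrow> (nat \<Rightarrow> real) \<Rightarrow> nat \<Rightarrow> nat \<Rightarrow> (real \<Rightarrow> real \<Rightarrow> real) \<Rightarrow> nat \<Rightarrow> nat \<Rightarrow> real" where
  "Nabla y z t k f i j = (-1) ^ (t + k) * Delta y z t k f i j"

end

theory Submission
  imports Defs
begin

text \<open>
  Newton interpolation of \<open>g\<close> at the nodes \<open>x\<^sub>M, x\<^bsub>M-1\<^esub>, \<dots>\<close>, with a remainder that iterated summation
  by parts turns into a sum of \<open>m\<close>-th divided differences over consecutive nodes, expresses
  \<open>g (x\<^sub>s)\<close> through the divided differences in the claim. Weighting this identity and summing over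
  \<open>s\<close> gives the one-variable version of the theorem. The two-variable version follows by using it
  first in \<open>z\<close> and then in \<open>y\<close>, applied to the functions \<open>u \<mapsto> [z\<^sub>j, \<dots>, z\<^bsub>j+k\<^esub>; f(u, \<cdot>)]\<close>.
\<close>

lemma gen_power_Suc: "gen_power x k i (Suc l) = gen_power x k i l * (x (k - l) - x i)"
  by (simp add: gen_power_def)

lemma gen_power_Suc_Suc:
  "gen_power x (Suc k) i (Suc l) = (x (Suc k) - x i) * gen_power x k i l"
  unfolding gen_power_def by (subst prod.lessThan_Suc_shift) (simp add: o_def)

text \<open>The factor with \<open>j = k - i\<close> is zero. This trims the sums over
  \<open>s\<close> to \<open>M - t\<close> and removes a boundary term in the summation by
  parts.\<close>

lemma gen_power_eq_0:
  assumes "i \<le> k" and "k < i + l"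
  shows "gen_power x k i l = 0"
  unfolding gen_power_def
proof (rule prod_zero)
  show "\<exists>j\<in>{..<l}. x (k - j) - x i = 0"
    using assms by (intro bexI[of _ "k - i"]) auto
qed simp

text \<open>The two products share the factors with indices \<open>t + 1\<close> to
  \<open>t + m - 1\<close>; only the factors at \<open>t + m\<close> and at \<open>t\<close>
  differ.\<close>

lemma gen_power_diff:
  assumes "0 < m"
  shows "gen_power x (t + m) s m - gen_power x (t + m - 1) s m
    = gen_power x (t + m - 1) s (m - 1) * (x (t + m) - x t)"
proof -
  obtain q where "m = Suc q"
    using assms by (cases m) auto
  then show ?thesis
    using gen_power_Suc_Suc[of x "t + q" s q] gen_power_Suc[of x "t + q" s q]
    by (simp add: algebra_simps)
qed

lemma summation_by_parts:
  fixes c D :: "nat \<Rightarrow> 'a::comm_ring"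
  assumes "s \<le> K"
  shows "(\<Sum>t=s..K. (c (Suc t) - c t) * D t)
    = c (Suc K) * D K - c s * D s - (\<Sum>t=s..<K. c (Suc t) * (D (Suc t) - D t))"
  using assms by (induction K rule: dec_induct) (simp_all add: algebra_simps)

lemma divdiff_Suc_times:
  assumes "inj_on x {1..M}" and "1 \<le> t" and "t + Suc l \<le> M"
  shows "divdiff x g t (Suc l) * (x (t + Suc l) - x t) = divdiff x g (Suc t) l - divdiff x g t l"
proof -
  have "x (t + Suc l) \<noteq> x t"
    using inj_onD[OF assms(1), of "t + Suc l" t] assms(2,3) by auto
  then show ?thesis
    by simp
qed

text \<open>For \<open>s > M - m\<close> the sum is empty: \<open>x s\<close> is then one of the
  \<open>m\<close> interpolation nodes, where the Newton polynomial is exact.\<close>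

definition newton_remainder ::
    "(nat \<Rightarrow> real) \<Rightarrow> (real \<Rightarrow> real) \<Rightarrow> nat \<Rightarrow> nat \<Rightarrow> nat \<Rightarrow> real" where
  "newton_remainder x g M s m = (\<Sum>t=s..M-m. gen_power x (t + m - 1) s (m - 1)
     * ((-1) ^ m * divdiff x g t m) * (x (t + m) - x t))"

lemma newton_remainder_1:
  assumes "inj_on x {1..M}" and "1 \<le> s" and "s \<le> M"
  shows "newton_remainder x g M s 1 = g (x s) - g (x M)"
proof -
  have eq: "{s..M - 1} = {s..<M}"
    using assms by auto
  have "newton_remainder x g M s 1 = - (\<Sum>t=s..<M. g (x (Suc t)) - g (x t))"
    unfolding newton_remainder_def eq sum_negf[symmetric]
    using divdiff_Suc_times[OF assms(1), of _ 0 g] assms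
    by (intro sum.cong) (auto simp: gen_power_def simp del: divdiff.simps(2))
  also have "\<dots> = g (x s) - g (x M)"
    using sum_Suc_diff'[OF assms(3), of "\<lambda>t. g (x t)"] by simp
  finally show ?thesis .
qed

lemma newton_remainder_Suc:
  assumes "inj_on x {1..M}" and "1 \<le> s" and "s \<le> M" and "0 < m" and "m < M"
  shows "newton_remainder x g M s m
    = gen_power x M s m * ((-1) ^ m * divdiff x g (M - m) m) + newton_remainder x g M s (Suc m)"
proof (cases "s \<le> M - m")
  case False
  \<comment> \<open>Both remainders are empty sums, and \<open>gen_power x M s m\<close> contains
    the factor \<open>x s - x s\<close>.\<close>
  then show ?thesis
    using assms by (simp add: newton_remainder_def gen_power_eq_0)
next
  case True
  \<comment> \<open>By \<open>gen_power_diff\<close>, the coefficients in the remainder are the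
    increments of \<open>c\<close>.\<close>
  define c where "c t = gen_power x (t + m - 1) s m" for t
  define D where "D t = divdiff x g t m" for t
  have "c s = 0"
    unfolding c_def using assms by (intro gen_power_eq_0) auto
  have "newton_remainder x g M s m = (-1) ^ m * (\<Sum>t=s..M-m. (c (Suc t) - c t) * D t)"
    unfolding newton_remainder_def sum_distrib_left
    using gen_power_diff[OF assms(4), of x _ s]
    by (intro sum.cong) (simp_all add: c_def D_def)
  also have "\<dots> = gen_power x M s m * ((-1) ^ m * divdiff x g (M - m) m)
      - (-1) ^ m * (\<Sum>t=s..<M-m. c (Suc t) * (D (Suc t) - D t))"
    unfolding summation_by_parts[OF True] using \<open>c s = 0\<close> assms
    by (simp add: c_def D_def algebra_simps)
  \<comment> \<open>The increments of \<open>D\<close> are the numerators of the divided differences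
    of order \<open>m + 1\<close>.\<close>
  also have "(\<Sum>t=s..<M-m. c (Suc t) * (D (Suc t) - D t))
      = (\<Sum>t=s..M - Suc m. c (Suc t) * (divdiff x g t (Suc m) * (x (t + Suc m) - x t)))"
    using divdiff_Suc_times[OF assms(1), of _ m g] assms
    by (intro sum.cong) (auto simp: D_def simp del: divdiff.simps(2))
  also have "(-1) ^ m * \<dots> = - newton_remainder x g M s (Suc m)"
    unfolding newton_remainder_def sum_distrib_left sum_negf[symmetric]
    by (intro sum.cong) (simp_all add: c_def)
  finally show ?thesis
    by simp
qed

text \<open>The sign \<open>(-1) ^ t\<close> turns the product into Newton's basis
  \<open>(x s - x M) ... (x s - x (M - t + 1))\<close>. For \<open>m = 1\<close> the remainder
  telescopes; each further step splits one term off it.\<close>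

lemma newton_backward:
  assumes "inj_on x {1..M}" and "1 \<le> s" and "s \<le> M" and "0 < m" and "m \<le> M"
  shows "g (x s) = (\<Sum>t=0..m-1. gen_power x M s t * ((-1) ^ t * divdiff x g (M - t) t))
    + newton_remainder x g M s m"
  using assms(4,5)
proof (induction m rule: nat_induct_non_zero)
  case 1
  show ?case
    using newton_remainder_1[OF assms(1-3)] by (simp add: gen_power_def)
next
  case (Suc m)
  then obtain q where "m = Suc q"
    by (cases m) auto
  then show ?case
    using Suc newton_remainder_Suc[OF assms(1-3), of m g] by simp
qed

lemma sum_triangle_swap:
  fixes F :: "nat \<Rightarrow> nat \<Rightarrow> 'a::comm_monoid_add"
  assumes "K \<le> M"
  shows "(\<Sum>s=1..M. \<Sum>t=s..K. F s t) = (\<Sum>t=1..K. \<Sum>s=1..t. F s t)"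
proof -
  have "(\<Sum>s=1..M. \<Sum>t=s..K. F s t) = (\<Sum>s\<in>{1..M}. \<Sum>t\<in>{t\<in>{1..K}. s \<le> t}. F s t)"
    by (intro sum.cong) auto
  also have "\<dots> = (\<Sum>t\<in>{1..K}. \<Sum>s\<in>{s\<in>{1..M}. s \<le> t}. F s t)"
    by (rule sum.swap_restrict) auto
  also have "\<dots> = (\<Sum>t=1..K. \<Sum>s=1..t. F s t)"
    using assms by (intro sum.cong) auto
  finally show ?thesis .
qed

lemma weighted_newton_backward:
  assumes "inj_on x {1..M}" and "0 < m" and "m \<le> M"
  shows "(\<Sum>s=1..M. w s * g (x s)) =
      (\<Sum>t=0..m-1. \<Sum>s=1..M-t. w s * gen_power x M s t * ((-1) ^ t * divdiff x g (M - t) t))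
    + (\<Sum>t=1..M-m. \<Sum>s=1..t. w s * gen_power x (t + m - 1) s (m - 1)
         * ((-1) ^ m * divdiff x g t m) * (x (t + m) - x t))"
proof -
  have "(\<Sum>s=1..M. w s * g (x s)) =
      (\<Sum>s=1..M. \<Sum>t=0..m-1. w s * gen_power x M s t * ((-1) ^ t * divdiff x g (M - t) t))
    + (\<Sum>s=1..M. \<Sum>t=s..M-m. w s * gen_power x (t + m - 1) s (m - 1)
         * ((-1) ^ m * divdiff x g t m) * (x (t + m) - x t))"
    unfolding sum.distrib[symmetric]
  proof (rule sum.cong)
    fix s
    assume "s \<in> {1..M}"
    then show "w s * g (x s) =
        (\<Sum>t=0..m-1. w s * gen_power x M s t * ((-1) ^ t * divdiff x g (M - t) t))
      + (\<Sum>t=s..M-m. w s * gen_power x (t + m - 1) s (m - 1)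
           * ((-1) ^ m * divdiff x g t m) * (x (t + m) - x t))"
      using newton_backward[OF assms(1) _ _ assms(2,3), of s g]
      by (simp add: newton_remainder_def distrib_left sum_distrib_left mult.assoc)
  qed simp
  also have "(\<Sum>s=1..M. \<Sum>t=0..m-1. w s * gen_power x M s t * ((-1) ^ t * divdiff x g (M - t) t))
      = (\<Sum>t=0..m-1. \<Sum>s=1..M. w s * gen_power x M s t * ((-1) ^ t * divdiff x g (M - t) t))"
    by (rule sum.swap)
  \<comment> \<open>The dropped terms have \<open>s > M - t\<close>, so their product
    vanishes.\<close>
  also have "\<dots> =
      (\<Sum>t=0..m-1. \<Sum>s=1..M-t. w s * gen_power x M s t * ((-1) ^ t * divdiff x g (M - t) t))"
    by (intro sum.cong[OF refl] sum.mono_neutral_right) (auto simp: gen_power_eq_0)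
  finally show ?thesis
    by (simp only: sum_triangle_swap[OF diff_le_self])
qed

text \<open>This is the expansion in \<open>y\<close> for a fixed divided difference in
  \<open>z\<close>. Keeping \<open>q\<close> and \<open>R\<close> arbitrary lets it serve both the
  Newton terms and the remainder terms in \<open>z\<close>.\<close>

lemma weighted_newton_backward_Nabla:
  assumes "inj_on y {1..M}" and "0 < m" and "m \<le> M"
  shows "(\<Sum>i=1..M. \<Sum>r\<in>R. p i r * q r * ((-1) ^ k * divdiff z (f (y i)) j k)) =
      (\<Sum>t=0..m-1. \<Sum>s=1..M-t. \<Sum>r\<in>R.
         p s r * q r * gen_power y M s t * Nabla y z t k f (M - t) j)
    + (\<Sum>t=1..M-m. \<Sum>s=1..t. \<Sum>r\<in>R.
         p s r * q r * gen_power y (t + m - 1) s (m - 1) * Nabla y z m k f t j * (y (t + m) - y t))"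
  \<comment> \<open>The whole sum over \<open>r\<close>, with the sign \<open>(-1) ^ k\<close>, acts
    as the weight of row \<open>s\<close>.\<close>
  using weighted_newton_backward[OF assms,
      of "\<lambda>s. (-1) ^ k * (\<Sum>r\<in>R. p s r * q r)" "\<lambda>u. divdiff z (f u) j k"]
  by (simp add: Nabla_def Delta_def sum_distrib_left sum_distrib_right power_add mult_ac)

theorem theorem3p1:
  fixes m n M N :: nat
    and p :: "nat \<Rightarrow> nat \<Rightarrow> real"
    and y z :: "nat \<Rightarrow> real"
    and I1 J1 :: "real set"
    and f :: "real \<Rightarrow> real \<Rightarrow> real"
  assumes "0 < m" and "0 < n" and "0 < M" and "0 < N"
    and "m \<le> M" and "n \<le> N"
    and "inj_on y {1..M}" and "inj_on z {1..N}"
    and "\<forall>i\<in>{1..M}. y i \<in> I1" and "\<forall>j\<in>{1..N}. z j \<in> J1"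
  shows "(\<Sum>i=1..M. \<Sum>j=1..N. p i j * f (y i) (z j)) =
      (\<Sum>k=0..n-1. \<Sum>t=0..m-1. \<Sum>s=1..M-t. \<Sum>r=1..N-k.
         p s r * gen_power z N r k * gen_power y M s t
           * Nabla y z t k f (M - t) (N - k))
    + (\<Sum>k=0..n-1. \<Sum>t=1..M-m. \<Sum>s=1..t. \<Sum>r=1..N-k.
         p s r * gen_power z N r k * gen_power y (t + m - 1) s (m - 1)
           * Nabla y z m k f t (N - k) * (y (t + m) - y t))
    + (\<Sum>k=1..N-n. \<Sum>t=0..m-1. \<Sum>s=1..M-t. \<Sum>r=1..k.
         p s r * gen_power z (k + n - 1) r (n - 1) * gen_power y M s t
           * Nabla y z t n f (M - t) k * (z (k + n) - z k))
    + (\<Sum>k=1..N-n. \<Sum>t=1..M-m. \<Sum>s=1..t. \<Sum>r=1..k.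
         p s r * gen_power z (k + n - 1) r (n - 1) * gen_power y (t + m - 1) s (m - 1)
           * Nabla y z m n f t k * (y (t + m) - y t) * (z (k + n) - z k))"
proof -
  \<comment> \<open>For row \<open>i\<close>, \<open>?A\<close> is a Newton term and
    \<open>?B\<close> a remainder term of the expansion in \<open>z\<close>. In \<open>?B\<close>
    the gap \<open>z (k + n) - z k\<close> is grouped into the factor matched by
    \<open>q\<close>.\<close>
  let ?A = "\<lambda>k i. \<Sum>r=1..N-k. p i r * gen_power z N r k
    * ((-1) ^ k * divdiff z (f (y i)) (N - k) k)"
  let ?B = "\<lambda>k i. \<Sum>r=1..k. p i r * (gen_power z (k + n - 1) r (n - 1) * (z (k + n) - z k))
    * ((-1) ^ n * divdiff z (f (y i)) k n)"
  have "(\<Sum>i=1..M. \<Sum>j=1..N. p i j * f (y i) (z j))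
      = (\<Sum>i=1..M. (\<Sum>k=0..n-1. ?A k i) + (\<Sum>k=1..N-n. ?B k i))"
    using weighted_newton_backward[OF \<open>inj_on z {1..N}\<close> \<open>0 < n\<close> \<open>n \<le> N\<close>]
    by (simp add: mult_ac)
  also have "\<dots> = (\<Sum>k=0..n-1. \<Sum>i=1..M. ?A k i) + (\<Sum>k=1..N-n. \<Sum>i=1..M. ?B k i)"
    unfolding sum.distrib by (intro arg_cong2[of _ _ _ _ "(+)"] sum.swap)
  finally show ?thesis
    unfolding sum.distrib weighted_newton_backward_Nabla[where f = f and z = z,
      OF \<open>inj_on y {1..M}\<close> \<open>0 < m\<close> \<open>m \<le> M\<close>]
    by (simp add: mult_ac)
qed

end
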